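(* Let $\mathcal{M}_{pi}$ be the set of all partial isometries in a von Neumann algebra $\mathcal{M}$, and let $\preceq$ be the star order on $\mathcal{M}$. The supremum of every bounded subset of $\mathcal{M}_{pi}$ in $(\mathcal{M},\preceq)$ is a partial isometry. The infimum of every nonempty subset of $\mathcal{M}_{pi}$ in $(\mathcal{M},\preceq)$ is a partial isometry. (In particular, these suprema and infima exist.)
   Context: A von Neumann algebra is a strongly closed C*-subalgebra of the C*-algebra $\mathscr{B}(\mathscr{H})$ of all bounded operators on a complex Hilbert space $\mathscr{H}$. The star order on a von Neumann algebra $\mathcal{M}$ is the partial order defined by $x\preceq y$ if and only if $x^*x=x^*y$ and $xx^*=yx^*$. "Bounded" means order bounded in $(\mathcal{M},\preceq)$, i.e. having an upper and a lower bound in $\mathcal{M}$ with respect to $\preceq$ (since $0\preceq x$ for all $x$, this amounts to being bounded above). The empty set is allowed in the statement about suprema; its supremum is $0$. *)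

theory Defs
  imports "HOL-Analysis.Analysis" "HOL-Algebra.Order"
begin

text \<open>
  Complex Hilbert spaces are built on top of the library's real Hilbert spaces: the real inner
  product (and hence the norm, the metric and completeness) is the one induced by the real part
  of the complex inner product, which is linear in its first argument. Positive definiteness of
  the complex inner product is inherited from that of \<open>inner\<close>, since \<open>cinner x x\<close> is real by
  conjugate symmetry.
\<close>

class complex_hilbert_space = real_inner + complete_space +
  fixes scaleC :: "complex \<Rightarrow> 'a \<Rightarrow> 'a"  (infixr \<open>*\<^sub>C\<close> 75)
    and cinner :: "'a \<Rightarrow> 'a \<Rightarrow> complex"
  assumes scaleC_add_right: "c *\<^sub>C (x + y) = c *\<^sub>C x + c *\<^sub>C y"
    and scaleC_add_left: "(c + d) *\<^sub>C x = c *\<^sub>C x + d *\<^sub>C x"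
    and scaleC_scaleC: "c *\<^sub>C d *\<^sub>C x = (c * d) *\<^sub>C x"
    and scaleC_of_real: "complex_of_real r *\<^sub>C x = r *\<^sub>R x"
    and cinner_commute: "cinner x y = cnj (cinner y x)"
    and cinner_add_left: "cinner (x + y) z = cinner x z + cinner y z"
    and cinner_scaleC_left: "cinner (c *\<^sub>C x) y = c * cinner x y"
    and Re_cinner: "Re (cinner x y) = inner x y"

lemma cinner_self: "cinner (x :: 'a::complex_hilbert_space) x = complex_of_real ((norm x)\<^sup>2)"
proof (rule complex_eqI)
  show "Re (cinner x x) = Re (complex_of_real ((norm x)\<^sup>2))"
    by (simp add: Re_cinner power2_norm_eq_inner)
  have "Im (cinner x x) = Im (cnj (cinner x x))"
    by (rule arg_cong[OF cinner_commute])
  then show "Im (cinner x x) = Im (complex_of_real ((norm x)\<^sup>2))"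
    by simp
qed

lemma norm_scaleC: "norm (c *\<^sub>C (x :: 'a::complex_hilbert_space)) = cmod c * norm x"
proof -
  have "cinner (c *\<^sub>C x) (c *\<^sub>C x) = c * cnj (cinner (c *\<^sub>C x) x)"
    by (subst cinner_scaleC_left, subst cinner_commute, rule refl)
  also have "\<dots> = (c * cnj c) * cnj (cinner x x)"
    by (simp add: cinner_scaleC_left)
  also have "\<dots> = complex_of_real ((cmod c * norm x)\<^sup>2)"
    by (simp add: cinner_self complex_norm_square[symmetric] power_mult_distrib)
  finally have "(norm (c *\<^sub>C x))\<^sup>2 = (cmod c * norm x)\<^sup>2"
    by (simp only: cinner_self of_real_eq_iff)
  then show ?thesis
    by (simp add: power2_eq_iff_nonneg)
qed

lemma bounded_linear_scaleC: "bounded_linear (\<lambda>x :: 'a::complex_hilbert_space. c *\<^sub>C x)"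
proof (rule bounded_linear_intro[where K = "cmod c"])
  show "c *\<^sub>C (r *\<^sub>R x) = r *\<^sub>R (c *\<^sub>C x)" for r and x :: 'a
    by (simp only: scaleC_of_real[symmetric] scaleC_scaleC mult.commute)
qed (auto simp: scaleC_add_right norm_scaleC mult.commute)

text \<open>
  The type of \<open>blinfun\<close> consists of the bounded \<^emph>\<open>real\<close>-linear maps; \<open>B(H)\<close> is carved out by
  complex homogeneity.
\<close>

definition bounded_operators :: "('a::complex_hilbert_space \<Rightarrow>\<^sub>L 'a) set"
  where "bounded_operators = {T. \<forall>c x. blinfun_apply T (c *\<^sub>C x) = c *\<^sub>C blinfun_apply T x}"

lift_definition scaleC_op ::
    "complex \<Rightarrow> ('a::complex_hilbert_space \<Rightarrow>\<^sub>L 'a) \<Rightarrow> ('a \<Rightarrow>\<^sub>L 'a)"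
  is "\<lambda>c T x. c *\<^sub>C T x"
  by (rule bounded_linear_compose[OF bounded_linear_scaleC])

text \<open>
  On \<open>bounded_operators\<close> the adjoint exists by the Riesz representation theorem, and it is unique.
  For maps that are only real-linear the description below need not denote anything.
\<close>

definition adj :: "('a::complex_hilbert_space \<Rightarrow>\<^sub>L 'a) \<Rightarrow> ('a \<Rightarrow>\<^sub>L 'a)"
  where "adj T =
    (THE S. \<forall>x y. cinner (blinfun_apply T x) y = cinner x (blinfun_apply S y))"

lemma adj_eqI:
  fixes T S :: "'a::complex_hilbert_space \<Rightarrow>\<^sub>L 'a"
  assumes S: "\<And>x y. cinner (blinfun_apply T x) y = cinner x (blinfun_apply S y)"
  shows "adj T = S"
  unfolding adj_def
proof (rule the_equality)
  show "\<forall>x y. cinner (blinfun_apply T x) y = cinner x (blinfun_apply S y)"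
    using S by blast
  fix R :: "'a \<Rightarrow>\<^sub>L 'a"
  assume R: "\<forall>x y. cinner (blinfun_apply T x) y = cinner x (blinfun_apply R y)"
  show "R = S"
  proof (rule blinfun_eqI)
    fix y
    have "inner x (blinfun_apply R y) = inner x (blinfun_apply S y)" for x
    proof -
      have "cinner x (blinfun_apply R y) = cinner (blinfun_apply T x) y"
        by (rule R[THEN spec, THEN spec, symmetric])
      also have "\<dots> = cinner x (blinfun_apply S y)"
        by (rule S)
      finally have "Re (cinner x (blinfun_apply R y)) = Re (cinner x (blinfun_apply S y))"
        by (rule arg_cong)
      then show ?thesis
        unfolding Re_cinner .
    qed
    then have "\<forall>x. inner x (blinfun_apply R y) = inner x (blinfun_apply S y)"
      by (rule allI)
    then show "blinfun_apply R y = blinfun_apply S y"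
      by (rule iffD1[OF vector_eq_ldot])
  qed
qed

definition cstar_subalgebra :: "('a::complex_hilbert_space \<Rightarrow>\<^sub>L 'a) set \<Rightarrow> bool"
  where "cstar_subalgebra A \<longleftrightarrow>
    A \<subseteq> bounded_operators \<and>
    0 \<in> A \<and>
    (\<forall>x\<in>A. \<forall>y\<in>A. x + y \<in> A) \<and>
    (\<forall>c. \<forall>x\<in>A. scaleC_op c x \<in> A) \<and>
    (\<forall>x\<in>A. \<forall>y\<in>A. x o\<^sub>L y \<in> A) \<and>
    (\<forall>x\<in>A. adj x \<in> A) \<and>
    closed A"

text \<open>The identity operator is not required to belong to a von Neumann algebra.\<close>

definition von_neumann_algebra :: "('a::complex_hilbert_space \<Rightarrow>\<^sub>L 'a) set \<Rightarrow> bool"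
  where "von_neumann_algebra M \<longleftrightarrow>
    cstar_subalgebra M \<and>
    closedin (subtopology strong_operator_topology bounded_operators) M"

definition projection_op :: "('a::complex_hilbert_space \<Rightarrow>\<^sub>L 'a) \<Rightarrow> bool"
  where "projection_op p \<longleftrightarrow> adj p = p \<and> p o\<^sub>L p = p"

definition partial_isometries ::
    "('a::complex_hilbert_space \<Rightarrow>\<^sub>L 'a) set \<Rightarrow> ('a \<Rightarrow>\<^sub>L 'a) set"
  where "partial_isometries M = {v \<in> M. projection_op (adj v o\<^sub>L v)}"

definition star_order ::
    "('a::complex_hilbert_space \<Rightarrow>\<^sub>L 'a) set \<Rightarrow> ('a \<Rightarrow>\<^sub>L 'a) gorder"
  where "star_order M =
    \<lparr>carrier = M, eq = (=),
     le = (\<lambda>x y. adj x o\<^sub>L x = adj x o\<^sub>L y \<and> x o\<^sub>L adj x = y o\<^sub>L adj x)\<rparr>"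

definition order_bounded :: "('a, 'b) gorder_scheme \<Rightarrow> 'a set \<Rightarrow> bool"
  where "order_bounded L A \<longleftrightarrow> Upper L A \<noteq> {} \<and> Lower L A \<noteq> {}"

definition is_supremum :: "('a, 'b) gorder_scheme \<Rightarrow> 'a \<Rightarrow> 'a set \<Rightarrow> bool"
  where "is_supremum L s A \<longleftrightarrow> least L s (Upper L A)"

definition is_infimum :: "('a, 'b) gorder_scheme \<Rightarrow> 'a \<Rightarrow> 'a set \<Rightarrow> bool"
  where "is_infimum L i A \<longleftrightarrow> greatest L i (Lower L A)"

end

theory Submission
  imports Defs
begin

text \<open>
  Fix a set \<open>A\<close> of partial isometries of \<open>M\<close>, let \<open>N\<close> be the common kernel of its members and
  \<open>p\<close> the projection onto the orthogonal complement of \<open>N\<close>, that is, onto the closed span of all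
  initial spaces. An operator \<open>y\<close> above \<open>v\<close> in the star order agrees with \<open>v\<close> on the initial space
  of \<open>v\<close>, and \<open>y\<^sup>* y\<close> is the identity there. Hence for an upper bound \<open>y\<close> of \<open>A\<close> the product
  \<open>s = y p\<close> is the same for all upper bounds, and it is a partial isometry with initial projection
  \<open>p\<close>. It lies above every member of \<open>A\<close> and below every upper bound, so it is the supremum, as soon
  as it belongs to \<open>M\<close> (\<open>supremum_exists\<close>).

  The analytic part is therefore \<open>p \<in> M\<close> (\<open>joint_initial_projection\<close>). As \<open>M\<close> is strongly
  closed, it suffices to approximate \<open>p\<close> at finitely many vectors by elements \<open>1 - R\<close> of \<open>M\<close>, where
  \<open>R\<close> fixes \<open>N\<close> and is small at finitely many given vectors orthogonal to \<open>N\<close>. The argument of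
  Alaoglu and Birkhoff for the mean ergodic theorem supplies such \<open>R\<close>: the contractions \<open>R\<close> with
  \<open>1 - R \<in> M\<close> that respect \<open>N\<close> and its complement form a convex semigroup. The vector of
  least norm in the closed orbit of some \<open>u\<close> orthogonal to \<open>N\<close> is unique, hence fixed by the semigroup.
  The semigroup contains \<open>1 - v\<^sup>* v\<close> for each \<open>v \<in> A\<close>, so the fixed vector lies in \<open>N\<close> as well as
  in its complement, and it vanishes (\<open>damping_small\<close>).

  For infima, anything below a partial isometry is a partial isometry
  (\<open>star_le_partial_isometry\<close>). So the lower bounds of a nonempty set of partial isometries are
  partial isometries, bounded above by any member of the set, and their supremum is the infimum.
  The same lemma shows that every supremum and every infimum is a partial isometry.
\<close>

section \<open>Orthogonal projections and adjoints in a Hilbert space\<close>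

text \<open>
  Completeness replaces local compactness here: by the parallelogram law, the points of \<open>S\<close> that are
  nearly closest to \<open>a\<close> form closed sets with diameters tending to \<open>0\<close>. The lemma serves both
  orthogonal projections and the least-norm argument for orbits below.
\<close>

lemma nearest_point_exists:
  fixes a :: "'a::{real_inner,complete_space}"
  assumes S: "convex S" "closed S" "S \<noteq> {}"
  shows "\<exists>x\<in>S. \<forall>z\<in>S. dist a x \<le> dist a z"
proof -
  define d where "d = infdist a S"
  define r where "r n = d + inverse (real (Suc n))" for n
  define C where "C n = S \<inter> cball a (r n)" for n
  have d0: "0 \<le> d"
    unfolding d_def by (rule infdist_nonneg)
  have d_le: "d \<le> dist a z" if "z \<in> S" for z
    unfolding d_def by (rule infdist_le[OF that])
  have r_lim: "r \<longlonglongrightarrow> d"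
    unfolding r_def using tendsto_add[OF tendsto_const LIMSEQ_inverse_real_of_nat] by fastforce
  have close: "(dist x y)\<^sup>2 \<le> 4 * ((r n)\<^sup>2 - d\<^sup>2)" if "x \<in> C n" "y \<in> C n" for x y n
  proof -
    define m where "m = (1/2) *\<^sub>R x + (1/2) *\<^sub>R y"
    have xy: "x \<in> S" "y \<in> S" "dist a x \<le> r n" "dist a y \<le> r n"
      using that by (auto simp: C_def)
    have "m \<in> S"
      unfolding m_def using xy S(1) by (intro convexD) auto
    then have "d\<^sup>2 \<le> (dist a m)\<^sup>2"
      using d_le d0 by (intro power_mono)
    moreover have "(dist a x)\<^sup>2 \<le> (r n)\<^sup>2" "(dist a y)\<^sup>2 \<le> (r n)\<^sup>2"
      using xy by (auto intro: power_mono)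
    moreover have "(dist x y)\<^sup>2 = 2 * (dist a x)\<^sup>2 + 2 * (dist a y)\<^sup>2 - 4 * (dist a m)\<^sup>2"
      unfolding m_def
      by (simp add: dist_norm power2_norm_eq_inner inner_simps inner_commute algebra_simps)
    ultimately show ?thesis
      by (simp add: right_diff_distrib)
  qed
  have "\<exists>x. \<forall>n. x \<in> C n"
  proof (rule decreasing_closed_nest[of C])
    show "closed (C n)" for n
      unfolding C_def using S(2) by auto
    show "C n \<noteq> {}" for n
    proof -
      have "infdist a S < r n"
        by (simp add: r_def d_def)
      then obtain z where "z \<in> S" "dist a z < r n"
        using S(3) by (auto simp: infdist_notempty cINF_less_iff)
      then show ?thesis
        by (auto simp: C_def)
    qed
    show "C n \<subseteq> C m" if "m \<le> n" for m n
    proof -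
      have "inverse (real (Suc n)) \<le> inverse (real (Suc m))"
        using that by (intro le_imp_inverse_le) auto
      then have "r n \<le> r m"
        by (simp add: r_def)
      then show ?thesis
        by (auto simp: C_def)
    qed
    show "\<exists>n. \<forall>x\<in>C n. \<forall>y\<in>C n. dist x y < e" if "e > 0" for e
    proof -
      have "(\<lambda>n. 4 * ((r n)\<^sup>2 - d\<^sup>2)) \<longlonglongrightarrow> 4 * (d\<^sup>2 - d\<^sup>2)"
        by (intro tendsto_intros r_lim)
      then have "\<forall>\<^sub>F n in sequentially. 4 * ((r n)\<^sup>2 - d\<^sup>2) < e\<^sup>2"
        using that by (intro order_tendstoD(2)) auto
      then obtain n where n: "4 * ((r n)\<^sup>2 - d\<^sup>2) < e\<^sup>2"
        by (auto simp: eventually_sequentially)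
      have "dist x y < e" if "x \<in> C n" "y \<in> C n" for x y
        using close[OF that] n \<open>e > 0\<close> by (intro power2_less_imp_less[of _ e]) auto
      then show ?thesis
        by blast
    qed
    show "\<exists>x. \<forall>n. x \<in> C n" if "\<And>n. a \<in> C n" for a
      using that by blast
  qed
  then obtain x where x: "\<And>n. x \<in> C n"
    by blast
  have "x \<in> S"
    using x by (auto simp: C_def)
  moreover have "dist a x \<le> d"
    using x by (intro LIMSEQ_le_const[OF r_lim]) (auto simp: C_def)
  ultimately show ?thesis
    using d_le by (blast intro: order_trans)
qed

lemma orthogonal_decomposition:
  fixes x :: "'a::{real_inner,complete_space}"
  assumes S: "subspace S" "closed S"
  shows "\<exists>u\<in>S. \<forall>z\<in>S. inner (x - u) z = 0"
proof -
  have cS: "convex S"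
    using S(1) by (rule subspace_imp_convex)
  obtain u where u: "u \<in> S" "\<forall>z\<in>S. dist x u \<le> dist x z"
    using nearest_point_exists[OF cS S(2)] subspace_0[OF S(1)] by blast
  have le: "inner (x - u) z \<le> 0" if "z \<in> S" for z
    using any_closest_point_dot[OF cS S(2) u(1) _ u(2), of "u + z"]
      subspace_add[OF S(1) u(1) that] by simp
  have "inner (x - u) z = 0" if "z \<in> S" for z
    using le[OF that] le[OF subspace_neg[OF S(1) that]] by simp
  with u(1) show ?thesis
    by blast
qed

lemma orthogonal_projection_exists:
  fixes S :: "'a::{real_inner,complete_space} set"
  assumes S: "subspace S" "closed S"
  shows "\<exists>q :: 'a \<Rightarrow>\<^sub>L 'a. \<forall>x. q x \<in> S \<and> (\<forall>z\<in>S. inner (x - q x) z = 0)"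
proof -
  obtain f where f: "\<And>x. f x \<in> S" "\<And>x z. z \<in> S \<Longrightarrow> inner (x - f x) z = 0"
    using orthogonal_decomposition[OF S] by metis
  \<comment> \<open>Linearity of \<open>f\<close> follows from uniqueness of the decomposition.\<close>
  have unique: "f x = u" if "u \<in> S" "\<And>z. z \<in> S \<Longrightarrow> inner (x - u) z = 0" for x u
  proof -
    have "f x - u \<in> S"
      using S(1) f(1) that(1) by (rule subspace_diff)
    then have "inner (f x - u) (f x - u) = 0"
      using f(2)[of "f x - u" x] that(2)[of "f x - u"] by (simp add: inner_diff_left)
    then show ?thesis
      by simp
  qed
  have "bounded_linear f"
  proof (rule bounded_linear_intro[where K = 1])
    show "f (x + y) = f x + f y" for x y
    proof (rule unique)
      show "inner (x + y - (f x + f y)) z = 0" if "z \<in> S" for z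
        using f(2)[OF that, of x] f(2)[OF that, of y] by (simp add: inner_simps)
    qed (simp add: subspace_add S f)
    show "f (r *\<^sub>R x) = r *\<^sub>R f x" for r x
    proof (rule unique)
      show "inner (r *\<^sub>R x - r *\<^sub>R f x) z = 0" if "z \<in> S" for z
        using f(2)[OF that, of x] by (simp flip: scaleR_diff_right)
    qed (simp add: subspace_scale S f)
    show "norm (f x) \<le> norm x * 1" for x
    proof -
      have "(norm x)\<^sup>2 = (norm (f x))\<^sup>2 + (norm (x - f x))\<^sup>2"
        using f(2)[OF f(1), of x x]
        by (simp add: power2_norm_eq_inner inner_simps inner_commute)
      then show ?thesis
        by (simp add: norm_le_square flip: power2_norm_eq_inner)
    qed
  qed
  then have "blinfun_apply (Blinfun f) = f"
    by (rule bounded_linear_Blinfun_apply)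
  with f show ?thesis
    by (intro exI[of _ "Blinfun f"]) simp
qed

lemma riesz_representation:
  fixes f :: "'a::{real_inner,complete_space} \<Rightarrow> real"
  assumes f: "bounded_linear f"
  shows "\<exists>w. \<forall>x. f x = inner x w"
proof (cases "\<forall>x. f x = 0")
  case True
  then show ?thesis
    by (intro exI[of _ 0]) simp
next
  case False
  then obtain x\<^sub>0 where x\<^sub>0: "f x\<^sub>0 \<noteq> 0"
    by blast
  interpret f: bounded_linear f
    by (rule f)
  have "subspace {x. f x = 0}"
    by (auto simp: subspace_def f.add f.scaleR f.zero)
  moreover have "closed {x. f x = 0}"
    by (intro closed_Collect_eq continuous_intros linear_continuous_on f)
  ultimately obtain k where k: "f k = 0" "\<And>z. f z = 0 \<Longrightarrow> inner (x\<^sub>0 - k) z = 0"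
    using orthogonal_decomposition[of "{x. f x = 0}" x\<^sub>0] by auto
  define u where "u = x\<^sub>0 - k"
  have fu: "f u \<noteq> 0"
    using x\<^sub>0 k(1) by (simp add: u_def f.diff)
  then have uu: "inner u u \<noteq> 0"
    using f.zero by auto
  have "f x = inner x ((f u / inner u u) *\<^sub>R u)" for x
  proof -
    have "inner u (x - (f x / f u) *\<^sub>R u) = 0"
      unfolding u_def[symmetric] using k(2)[folded u_def] fu by (simp add: f.diff f.scaleR)
    then have "inner x u = f x / f u * inner u u"
      by (simp add: inner_simps inner_commute)
    then show ?thesis
      using fu uu by simp
  qed
  then show ?thesis
    by blast
qed

lemma Im_cinner: "Im (cinner x y) = - inner (\<i> *\<^sub>C x) y"
  for x y :: "'a::complex_hilbert_space"
  by (simp add: cinner_scaleC_left flip: Re_cinner)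

lemma inner_scaleC_left: "inner (c *\<^sub>C x) y = inner x (cnj c *\<^sub>C y)"
  for x y :: "'a::complex_hilbert_space"
proof -
  have "cinner x (cnj c *\<^sub>C y) = cnj (cinner (cnj c *\<^sub>C y) x)"
    by (rule cinner_commute)
  also have "\<dots> = cinner (c *\<^sub>C x) y"
    by (simp add: cinner_scaleC_left cinner_commute[of x y])
  finally show ?thesis
    by (simp flip: Re_cinner)
qed

text \<open>
  The Riesz representation yields an adjoint for the real inner product. It is also the complex
  adjoint, since the imaginary part of \<open>cinner x y\<close> is, up to sign, the real inner product
  of \<open>\<i> *\<^sub>C x\<close> and \<open>y\<close>.
\<close>

lemma adjoint_exists:
  fixes T :: "'a::complex_hilbert_space \<Rightarrow>\<^sub>L 'a"
  assumes T: "T \<in> bounded_operators"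
  shows "\<exists>S :: 'a \<Rightarrow>\<^sub>L 'a. \<forall>x y. cinner (T x) y = cinner x (S y)"
proof -
  have "\<exists>w. \<forall>x. inner (T x) y = inner x w" for y
    by (rule riesz_representation)
      (intro bounded_linear_compose[OF bounded_linear_inner_left] blinfun.bounded_linear_right)
  then obtain S where S: "\<And>x y. inner (T x) y = inner x (S y)"
    by metis
  have eqI: "u = w" if "\<And>x. inner x u = inner x w" for u w :: 'a
    using that vector_eq_ldot by blast
  have "bounded_linear S"
  proof (rule bounded_linear_intro[where K = "norm T"])
    show "S (x + y) = S x + S y" for x y
      by (rule eqI) (simp add: inner_add_right flip: S)
    show "S (r *\<^sub>R x) = r *\<^sub>R S x" for r x
      by (rule eqI) (simp flip: S)
    show "norm (S y) \<le> norm y * norm T" for y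
    proof (cases "norm (S y) = 0")
      case False
      have "norm (S y) * norm (S y) = inner (T (S y)) y"
        by (simp add: S flip: power2_norm_eq_inner power2_eq_square)
      also have "\<dots> \<le> norm (T (S y)) * norm y"
        by (rule norm_cauchy_schwarz)
      also have "\<dots> \<le> (norm T * norm (S y)) * norm y"
        by (intro mult_right_mono norm_blinfun) auto
      finally show ?thesis
        using False by (simp add: ac_simps)
    qed auto
  qed
  then have apply_S: "blinfun_apply (Blinfun S) = S"
    by (rule bounded_linear_Blinfun_apply)
  have "cinner (T x) y = cinner x (S y)" for x y
  proof (rule complex_eqI)
    show "Re (cinner (T x) y) = Re (cinner x (S y))"
      by (simp add: Re_cinner S)
    have "\<i> *\<^sub>C T x = T (\<i> *\<^sub>C x)"
      using T by (simp add: bounded_operators_def)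
    then show "Im (cinner (T x) y) = Im (cinner x (S y))"
      by (simp add: Im_cinner S)
  qed
  with apply_S show ?thesis
    by (intro exI[of _ "Blinfun S"]) simp
qed

text \<open>
  By this identity and the next, computations with adjoints need only the real inner product.
\<close>

lemma inner_adj:
  fixes T :: "'a::complex_hilbert_space \<Rightarrow>\<^sub>L 'a"
  assumes "T \<in> bounded_operators"
  shows "inner (T x) y = inner x (adj T y)"
proof -
  obtain S :: "'a \<Rightarrow>\<^sub>L 'a" where S: "\<And>x y. cinner (T x) y = cinner x (S y)"
    using adjoint_exists[OF assms] by blast
  then have "adj T = S"
    by (rule adj_eqI)
  with S[of x y] show ?thesis
    by (simp flip: Re_cinner)
qed

lemma adj_eq_if_inner:
  fixes T S :: "'a::complex_hilbert_space \<Rightarrow>\<^sub>L 'a"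
  assumes "T \<in> bounded_operators" "\<And>x y. inner (T x) y = inner x (S y)"
  shows "adj T = S"
proof (rule blinfun_eqI)
  fix y
  have "\<forall>x. inner x (adj T y) = inner x (S y)"
    using assms(2) by (simp flip: inner_adj[OF assms(1)])
  then show "adj T y = S y"
    by (rule iffD1[OF vector_eq_ldot])
qed

section \<open>Partial isometries and the star order\<close>

lemma carrier_star_order [simp]: "carrier (star_order M) = M"
  by (simp add: star_order_def)

lemma star_le_iff:
  "x \<sqsubseteq>\<^bsub>star_order M\<^esub> y \<longleftrightarrow>
    (\<forall>z. adj x (x z) = adj x (y z)) \<and> (\<forall>z. x (adj x z) = y (adj x z))"
  by (simp add: star_order_def fun_eq_iff flip: blinfun_apply_inject)

lemma von_neumann_algebraD:
  assumes "von_neumann_algebra M"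
  shows "M \<subseteq> bounded_operators" "0 \<in> M"
    "\<And>x y. x \<in> M \<Longrightarrow> y \<in> M \<Longrightarrow> x + y \<in> M"
    "\<And>x y. x \<in> M \<Longrightarrow> y \<in> M \<Longrightarrow> x - y \<in> M"
    "\<And>r x. x \<in> M \<Longrightarrow> r *\<^sub>R x \<in> M"
    "\<And>x y. x \<in> M \<Longrightarrow> y \<in> M \<Longrightarrow> x o\<^sub>L y \<in> M"
    "\<And>x. x \<in> M \<Longrightarrow> adj x \<in> M"
proof -
  note M = assms[unfolded von_neumann_algebra_def cstar_subalgebra_def]
  show scale: "r *\<^sub>R x \<in> M" if "x \<in> M" for r x
  proof -
    have "scaleC_op (complex_of_real r) x = r *\<^sub>R x"
      by (rule blinfun_eqI) (simp add: scaleC_op.rep_eq scaleC_of_real blinfun.scaleR_left)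
    with M that show ?thesis
      by metis
  qed
  show add: "x + y \<in> M" if "x \<in> M" "y \<in> M" for x y
    using M that by blast
  show "x - y \<in> M" if "x \<in> M" "y \<in> M" for x y
    using add[OF that(1) scale[OF that(2), of "- 1"]] by simp
qed (use assms in \<open>auto simp: von_neumann_algebra_def cstar_subalgebra_def\<close>)

text \<open>
  If \<open>v\<^sup>* v\<close> is idempotent and \<open>d = v\<^sup>* v x - x\<close>, then \<open>v\<^sup>* v d = 0\<close>, so \<open>\<parallel>v d\<parallel>\<^sup>2 = \<langle>v\<^sup>* v d, d\<rangle> = 0\<close>.
\<close>

lemma projection_adj_compose_iff:
  assumes v: "v \<in> bounded_operators" "adj v \<in> bounded_operators"
  shows "projection_op (adj v o\<^sub>L v) \<longleftrightarrow> (\<forall>x. v (adj v (v x)) = v x)"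
proof
  assume "projection_op (adj v o\<^sub>L v)"
  then have idem: "adj v (v (adj v (v x))) = adj v (v x)" for x
    unfolding projection_op_def by (metis blinfun_apply_blinfun_compose)
  show "\<forall>x. v (adj v (v x)) = v x"
  proof
    fix x
    define d where "d = adj v (v x) - x"
    have "adj v (v d) = 0"
      by (simp add: d_def blinfun.diff_right idem)
    then have "inner (v d) (v d) = 0"
      by (simp add: inner_adj[OF v(1)])
    then show "v (adj v (v x)) = v x"
      by (simp add: d_def blinfun.diff_right)
  qed
next
  assume *: "\<forall>x. v (adj v (v x)) = v x"
  have "adj (adj v o\<^sub>L v) = adj v o\<^sub>L v"
  proof (rule adj_eq_if_inner)
    show "adj v o\<^sub>L v \<in> bounded_operators"
      using v by (simp add: bounded_operators_def)
    show "inner ((adj v o\<^sub>L v) x) y = inner x ((adj v o\<^sub>L v) y)" for x y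
      using inner_adj[OF v(1), of y "v x"] inner_adj[OF v(1), of x "v y"]
      by (simp add: inner_commute)
  qed
  then show "projection_op (adj v o\<^sub>L v)"
    unfolding projection_op_def by (auto intro!: blinfun_eqI simp: *)
qed

lemma partial_isometry_iff:
  assumes "von_neumann_algebra M" "v \<in> M"
  shows "v \<in> partial_isometries M \<longleftrightarrow> (\<forall>x. v (adj v (v x)) = v x)"
proof -
  have "v \<in> bounded_operators" "adj v \<in> bounded_operators"
    using von_neumann_algebraD(1,7)[OF assms(1)] assms(2) by auto
  then show ?thesis
    using assms(2) by (simp add: partial_isometries_def projection_adj_compose_iff)
qed

lemma adj_partial_isometry:
  assumes M: "von_neumann_algebra M" and v: "v \<in> partial_isometries M"
  shows "adj v (v (adj v x)) = adj v x"
proof -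
  have "v \<in> M"
    using v by (simp add: partial_isometries_def)
  then have b: "v \<in> bounded_operators"
    using von_neumann_algebraD(1)[OF M] by blast
  have "inner z (adj v (v (adj v x))) = inner z (adj v x)" for z
  proof -
    have "inner z (adj v (v (adj v x))) = inner (v z) (v (adj v x))"
      by (simp add: inner_adj[OF b])
    also have "\<dots> = inner (v (adj v (v z))) x"
      by (simp add: inner_adj[OF b] inner_commute[of "v z"] inner_commute[of "adj v (v z)"])
        (simp add: inner_commute flip: inner_adj[OF b])
    also have "\<dots> = inner z (adj v x)"
      using v \<open>v \<in> M\<close> by (simp add: partial_isometry_iff[OF M] inner_adj[OF b])
    finally show ?thesis .
  qed
  then show ?thesis
    using vector_eq_ldot by blast
qed

text \<open>
  The adjoint of the relation \<open>x\<^sup>* x = x\<^sup>* y\<close>: the operators \<open>x\<^sup>*\<close> and \<open>y\<^sup>*\<close> agree on the range of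
  \<open>x\<close>.
\<close>

lemma adj_apply_eq_of_star_le:
  assumes M: "von_neumann_algebra M" "x \<in> M" "y \<in> M" and le: "x \<sqsubseteq>\<^bsub>star_order M\<^esub> y"
  shows "adj y (x z) = adj x (x z)"
proof -
  have b: "x \<in> bounded_operators" "y \<in> bounded_operators"
    using von_neumann_algebraD(1)[OF M(1)] M by auto
  have xy: "adj x (x w) = adj x (y w)" for w
    using le by (simp add: star_le_iff)
  have "inner w (adj y (x z)) = inner w (adj x (x z))" for w
  proof -
    have "inner w (adj y (x z)) = inner z (adj x (y w))"
      by (simp add: inner_commute flip: inner_adj[OF b(1)] inner_adj[OF b(2)])
    also have "\<dots> = inner w (adj x (x z))"
      by (simp add: inner_commute flip: xy inner_adj[OF b(1)])
    finally show ?thesis .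
  qed
  then show ?thesis
    using vector_eq_ldot by blast
qed

text \<open>
  Since \<open>z z\<^sup>* = v z\<^sup>*\<close>, the kernel of \<open>v\<^sup>*\<close> is contained in that of \<open>z\<^sup>*\<close>, so the final projection
  \<open>v v\<^sup>*\<close> fixes the range of \<open>z\<close>. As \<open>v\<^sup>*\<close> agrees with \<open>z\<^sup>*\<close> on that range, this gives
  \<open>z = v v\<^sup>* z = v z\<^sup>* z = z z\<^sup>* z\<close>.
\<close>

lemma star_le_partial_isometry:
  assumes M: "von_neumann_algebra M" and z: "z \<in> M" and v: "v \<in> partial_isometries M"
    and le: "z \<sqsubseteq>\<^bsub>star_order M\<^esub> v"
  shows "z \<in> partial_isometries M"
proof -
  have vM: "v \<in> M"
    using v by (simp add: partial_isometries_def)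
  have b: "z \<in> bounded_operators" "v \<in> bounded_operators"
    using von_neumann_algebraD(1)[OF M] z vM by auto
  have zv: "z (adj z x) = v (adj z x)" for x
    using le by (simp add: star_le_iff)
  have vz: "adj v (z x) = adj z (z x)" for x
    by (rule adj_apply_eq_of_star_le[OF M z vM le])
  have ker: "adj z x = 0" if "adj v x = 0" for x
  proof -
    have "inner (adj z x) (adj z x) = inner (adj z x) (adj v x)"
      by (simp add: zv flip: inner_adj[OF b(1)] inner_adj[OF b(2)])
    with that show ?thesis
      by simp
  qed
  have "z (adj z (z x)) = z x" for x
  proof -
    define e where "e = z x - v (adj v (z x))"
    have ve: "adj v e = 0"
      unfolding e_def by (simp add: blinfun.diff_right adj_partial_isometry[OF M v])
    have "inner e e = inner (z x) e - inner (v (adj v (z x))) e"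
      by (simp add: e_def inner_diff_left)
    then have "e = 0"
      by (simp add: inner_adj[OF b(1)] inner_adj[OF b(2)] ve ker[OF ve])
    then have "z x = v (adj v (z x))"
      by (simp add: e_def)
    also have "\<dots> = z (adj z (z x))"
      by (simp add: vz zv)
    finally show ?thesis ..
  qed
  then show ?thesis
    using partial_isometry_iff[OF M z] by blast
qed

section \<open>The projection onto the joint initial space\<close>

definition orth :: "'a::real_inner set \<Rightarrow> 'a set"
  where "orth S = {u. \<forall>x\<in>S. inner u x = 0}"

lemma orth_closed_subspace: "subspace (orth S)" "closed (orth S)"
proof -
  show "subspace (orth S)"
    by (auto simp: subspace_def orth_def inner_simps)
  have "orth S = (\<Inter>x\<in>S. {u. inner u x = 0})"
    by (auto simp: orth_def)
  moreover have "closed {u. inner u x = 0}" for x :: 'a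
    by (intro closed_Collect_eq continuous_intros)
  ultimately show "closed (orth S)"
    by auto
qed

definition joint_kernel :: "('a::real_normed_vector \<Rightarrow>\<^sub>L 'a) set \<Rightarrow> 'a set"
  where "joint_kernel A = {x. \<forall>v\<in>A. v x = 0}"

lemma subspace_joint_kernel: "subspace (joint_kernel A)"
  by (auto simp: subspace_def joint_kernel_def blinfun.add_right blinfun.scaleR_right)

lemma closed_joint_kernel: "closed (joint_kernel A)"
proof -
  have "joint_kernel A = (\<Inter>v\<in>A. {x. blinfun_apply v x = 0})"
    by (auto simp: joint_kernel_def)
  moreover have "closed {x. blinfun_apply v x = 0}" for v :: "'a \<Rightarrow>\<^sub>L 'a"
    by (intro closed_Collect_eq continuous_intros)
  ultimately show ?thesis
    by auto
qed

text \<open>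
  For \<open>u\<close> orthogonal to the joint kernel with projection \<open>e\<close> onto \<open>E\<close>, the difference \<open>u - e\<close> is
  orthogonal to the ranges of all \<open>v\<^sup>*\<close>, so it lies in the joint kernel and is orthogonal to \<open>u\<close>; it
  is also orthogonal to \<open>e\<close>. Through this lemma, linear identities valid on all initial spaces
  extend to the orthogonal complement of the joint kernel.
\<close>

lemma orth_joint_kernel_subset:
  fixes A :: "('a::complex_hilbert_space \<Rightarrow>\<^sub>L 'a) set"
  assumes A: "A \<subseteq> bounded_operators"
    and E: "subspace E" "closed E" "\<And>v x. v \<in> A \<Longrightarrow> adj v x \<in> E"
  shows "orth (joint_kernel A) \<subseteq> E"
proof
  fix u
  assume u: "u \<in> orth (joint_kernel A)"
  obtain e where e: "e \<in> E" "\<And>z. z \<in> E \<Longrightarrow> inner (u - e) z = 0"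
    using orthogonal_decomposition[OF E(1,2)] by blast
  have "v (u - e) = 0" if v: "v \<in> A" for v
  proof -
    have "v \<in> bounded_operators"
      using A v by blast
    then have "inner (v (u - e)) (v (u - e)) = inner (u - e) (adj v (v (u - e)))"
      by (rule inner_adj)
    then show ?thesis
      using e(2)[OF E(3)[OF v]] by simp
  qed
  then have "inner u (u - e) = 0"
    using u by (auto simp: orth_def joint_kernel_def)
  then have "inner (u - e) (u - e) = 0"
    using e(2)[OF e(1)] by (simp add: inner_diff_left inner_diff_right inner_commute)
  then show "u \<in> E"
    using e(1) by simp
qed

text \<open>
  The convex semigroup of the ergodic argument. Membership in \<open>M\<close> is required of \<open>1 - R\<close> rather than
  of \<open>R\<close> because \<open>M\<close> may fail to contain the identity operator.
\<close>

definition damping_operators ::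
    "('a::complex_hilbert_space \<Rightarrow>\<^sub>L 'a) set \<Rightarrow> ('a \<Rightarrow>\<^sub>L 'a) set \<Rightarrow> ('a \<Rightarrow>\<^sub>L 'a) set"
  where "damping_operators M A = {R. id_blinfun - R \<in> M \<and> (\<forall>x. norm (R x) \<le> norm x) \<and>
    (\<forall>x\<in>joint_kernel A. R x = x) \<and> (\<forall>u\<in>orth (joint_kernel A). R u \<in> orth (joint_kernel A))}"

lemma id_damping:
  assumes "von_neumann_algebra M"
  shows "id_blinfun \<in> damping_operators M A"
  using von_neumann_algebraD(2)[OF assms] by (simp add: damping_operators_def)

lemma compose_damping:
  assumes M: "von_neumann_algebra M"
    and R: "R \<in> damping_operators M A" "R' \<in> damping_operators M A"
  shows "R o\<^sub>L R' \<in> damping_operators M A"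
proof -
  have "id_blinfun - (R o\<^sub>L R') =
      (id_blinfun - R) + (id_blinfun - R') - ((id_blinfun - R) o\<^sub>L (id_blinfun - R'))"
    by (rule blinfun_eqI) (simp add: blinfun.bilinear_simps)
  also have "\<dots> \<in> M"
  proof (rule von_neumann_algebraD(4)[OF M])
    have "id_blinfun - R \<in> M" "id_blinfun - R' \<in> M"
      using R by (auto simp: damping_operators_def)
    then show "id_blinfun - R + (id_blinfun - R') \<in> M"
        "(id_blinfun - R) o\<^sub>L (id_blinfun - R') \<in> M"
      by (auto intro: von_neumann_algebraD(3,6)[OF M])
  qed
  finally show ?thesis
    using R by (auto simp: damping_operators_def intro: order_trans)
qed

lemma convex_damping:
  assumes M: "von_neumann_algebra M"
  shows "convex (damping_operators M A)"
proof (rule convexI)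
  fix R R' and s t :: real
  assume R: "R \<in> damping_operators M A" "R' \<in> damping_operators M A"
    and st: "0 \<le> s" "0 \<le> t" "s + t = 1"
  have t: "t = 1 - s"
    using st by simp
  have "id_blinfun - (s *\<^sub>R R + t *\<^sub>R R') = s *\<^sub>R (id_blinfun - R) + t *\<^sub>R (id_blinfun - R')"
    by (simp add: t algebra_simps)
  also have "\<dots> \<in> M"
    using R by (intro von_neumann_algebraD(3,5)[OF M]) (auto simp: damping_operators_def)
  finally have 1: "id_blinfun - (s *\<^sub>R R + t *\<^sub>R R') \<in> M" .
  have 2: "norm ((s *\<^sub>R R + t *\<^sub>R R') x) \<le> norm x" for x
  proof -
    have "norm ((s *\<^sub>R R + t *\<^sub>R R') x) \<le> s * norm (R x) + t * norm (R' x)"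
      using st norm_triangle_ineq[of "s *\<^sub>R R x" "t *\<^sub>R R' x"]
      by (simp add: blinfun.bilinear_simps)
    also have "\<dots> \<le> s * norm x + t * norm x"
      using R st by (intro add_mono mult_left_mono) (auto simp: damping_operators_def)
    also have "\<dots> = norm x"
      by (simp add: t algebra_simps)
    finally show ?thesis .
  qed
  have 3: "(s *\<^sub>R R + t *\<^sub>R R') x = x" if "x \<in> joint_kernel A" for x
    using R that by (simp add: damping_operators_def blinfun.bilinear_simps t algebra_simps)
  have 4: "(s *\<^sub>R R + t *\<^sub>R R') u \<in> orth (joint_kernel A)" if "u \<in> orth (joint_kernel A)" for u
  proof -
    have "R u \<in> orth (joint_kernel A)" "R' u \<in> orth (joint_kernel A)"
      using R that by (auto simp: damping_operators_def)
    then show ?thesis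
      by (auto simp: blinfun.bilinear_simps intro!: subspace_add subspace_scale orth_closed_subspace)
  qed
  show "s *\<^sub>R R + t *\<^sub>R R' \<in> damping_operators M A"
    unfolding damping_operators_def using 1 2 3 4 by auto
qed

text \<open>
  These members force a vector fixed by the whole semigroup to be annihilated by every \<open>v \<in> A\<close>.
\<close>

lemma complement_damping:
  assumes M: "von_neumann_algebra M" and A: "A \<subseteq> partial_isometries M" and v: "v \<in> A"
  shows "id_blinfun - (adj v o\<^sub>L v) \<in> damping_operators M A"
proof -
  have vP: "v \<in> partial_isometries M" and vM: "v \<in> M"
    using A v by (auto simp: partial_isometries_def)
  have b: "v \<in> bounded_operators"
    using von_neumann_algebraD(1)[OF M] vM by blast
  have contraction: "norm (x - adj v (v x)) \<le> norm x" for x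
  proof -
    let ?y = "adj v (v x)"
    have "inner ?y (x - ?y) = inner (x - ?y) ?y"
      by (rule inner_commute)
    also have "\<dots> = inner (v (x - ?y)) (v x)"
      by (rule inner_adj[OF b, symmetric])
    also have "v (x - ?y) = 0"
      using vP vM by (simp add: blinfun.diff_right partial_isometry_iff[OF M])
    finally have "inner ?y (x - ?y) = 0"
      by simp
    then have "(norm x)\<^sup>2 = (norm (x - ?y))\<^sup>2 + (norm ?y)\<^sup>2"
      by (simp add: power2_norm_eq_inner inner_simps inner_commute)
    then show ?thesis
      by (simp add: norm_le_square flip: power2_norm_eq_inner)
  qed
  have "u - adj v (v u) \<in> orth (joint_kernel A)" if "u \<in> orth (joint_kernel A)" for u
  proof -
    have "inner (adj v (v u)) x = 0" if "x \<in> joint_kernel A" for x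
      using inner_adj[OF b, of x "v u"] that v by (simp add: joint_kernel_def inner_commute)
    with that show ?thesis
      by (simp add: orth_def inner_diff_left)
  qed
  moreover have "adj v o\<^sub>L v \<in> M"
    using vM by (intro von_neumann_algebraD(6,7)[OF M])
  ultimately show ?thesis
    using contraction v
    by (auto simp: damping_operators_def blinfun.diff_left joint_kernel_def)
qed

text \<open>
  \<open>W\<close> is the closed orbit of \<open>u\<close>, a convex set, and \<open>w\<close> its element of least norm. Every \<open>R\<close> in the
  semigroup maps \<open>W\<close> into itself without increasing norms, so \<open>R w = w\<close> by uniqueness. Thus \<open>w\<close> lies
  in the joint kernel as well as, with the orbit, in its orthogonal complement, whence \<open>w = 0\<close>.
\<close>

lemma damping_small:
  assumes M: "von_neumann_algebra M" and A: "A \<subseteq> partial_isometries M"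
    and u: "u \<in> orth (joint_kernel A)" and "e > 0"
  shows "\<exists>R\<in>damping_operators M A. norm (R u) < e"
proof -
  define W where "W = closure ((\<lambda>R. blinfun_apply R u) ` damping_operators M A)"
  have "convex W"
    unfolding W_def
    by (intro convex_closure convex_linear_image convex_damping[OF M]
        bounded_linear.linear blinfun.bounded_linear_left)
  moreover have "closed W"
    by (simp add: W_def)
  moreover have "W \<noteq> {}"
    using id_damping[OF M] by (auto simp: W_def)
  ultimately obtain w where w: "w \<in> W" "\<And>z. z \<in> W \<Longrightarrow> dist 0 w \<le> dist 0 z"
    using nearest_point_exists[of W 0] by blast
  have invariant: "R z \<in> W" if R: "R \<in> damping_operators M A" and z: "z \<in> W" for R z
  proof -
    have "blinfun_apply R ` W \<subseteq> W"
      unfolding W_def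
    proof (rule image_closure_subset)
      show "continuous_on (closure ((\<lambda>R. blinfun_apply R u) ` damping_operators M A)) R"
        by (intro continuous_intros)
      have "R (R' u) \<in> (\<lambda>R. blinfun_apply R u) ` damping_operators M A"
        if "R' \<in> damping_operators M A" for R'
        using compose_damping[OF M R that] by force
      then show "blinfun_apply R ` (\<lambda>R. blinfun_apply R u) ` damping_operators M A
          \<subseteq> closure ((\<lambda>R. blinfun_apply R u) ` damping_operators M A)"
        using closure_subset by blast
    qed simp
    with z show ?thesis
      by blast
  qed
  have fixed: "R w = w" if R: "R \<in> damping_operators M A" for R
  proof (rule any_closest_point_unique[OF \<open>convex W\<close> \<open>closed W\<close>])
    show "R w \<in> W"
      using R w(1) by (rule invariant)
    have "norm (R w) \<le> norm w"
      using R by (simp add: damping_operators_def)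
    then show "\<forall>z\<in>W. dist 0 (R w) \<le> dist 0 z"
      using w(2) by (fastforce intro: order_trans)
  qed (use w in auto)
  have "v w = 0" if v: "v \<in> A" for v
  proof -
    have "adj v (v w) = 0"
      using fixed[OF complement_damping[OF M A v]] by (simp add: blinfun.diff_left)
    moreover have "v (adj v (v w)) = v w"
      using A v partial_isometry_iff[OF M] by (auto simp: partial_isometries_def)
    ultimately show ?thesis
      by simp
  qed
  then have "w \<in> joint_kernel A"
    by (simp add: joint_kernel_def)
  moreover have "W \<subseteq> orth (joint_kernel A)"
    unfolding W_def using u
    by (intro closure_minimal orth_closed_subspace) (auto simp: damping_operators_def)
  moreover note w(1)
  ultimately have "inner w w = 0"
    unfolding orth_def by blast
  then have "0 \<in> W"
    using w(1) by simp
  then show ?thesis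
    using \<open>e > 0\<close> unfolding W_def closure_approachable by auto
qed

text \<open>
  Vectors are treated one after the other: once \<open>R\<close> is small on \<open>X\<close>, choose \<open>R'\<close> small at \<open>R u\<close>.
  As \<open>R'\<close> is a contraction, the product \<open>R' R\<close> remains small on \<open>X\<close>.
\<close>

lemma damping_small_finite:
  assumes M: "von_neumann_algebra M" and A: "A \<subseteq> partial_isometries M"
    and X: "finite X" "X \<subseteq> orth (joint_kernel A)" and "e > 0"
  shows "\<exists>R\<in>damping_operators M A. \<forall>u\<in>X. norm (R u) < e"
  using X
proof (induction X rule: finite_induct)
  case empty
  then show ?case
    using id_damping[OF M] by auto
next
  case (insert u X)
  then obtain R where R: "R \<in> damping_operators M A" "\<forall>u\<in>X. norm (R u) < e"
    by auto
  have "R u \<in> orth (joint_kernel A)"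
    using R(1) insert.prems by (auto simp: damping_operators_def)
  then obtain R' where R': "R' \<in> damping_operators M A" "norm (R' (R u)) < e"
    using damping_small[OF M A _ \<open>e > 0\<close>] by blast
  have "norm (R' (R x)) \<le> norm (R x)" for x
    using R'(1) by (simp add: damping_operators_def)
  then have "\<forall>x\<in>insert u X. norm ((R' o\<^sub>L R) x) < e"
    using R R' by (auto intro: le_less_trans)
  then show ?case
    using compose_damping[OF M R'(1) R(1)] by blast
qed

text \<open>
  A basic neighbourhood of \<open>p\<close> in the strong topology constrains the values at finitely many
  vectors only.
\<close>

lemma strong_closure_in_algebra:
  fixes p :: "'a::complex_hilbert_space \<Rightarrow>\<^sub>L 'a"
  assumes M: "von_neumann_algebra M" and p: "p \<in> bounded_operators"
    and approx: "\<And>X e. finite X \<Longrightarrow> e > 0 \<Longrightarrow> \<exists>m\<in>M. \<forall>x\<in>X. dist (m x) (p x) < e"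
  shows "p \<in> M"
proof (rule ccontr)
  assume "p \<notin> M"
  obtain F where F: "closedin strong_operator_topology F" "M = F \<inter> bounded_operators"
    using M unfolding von_neumann_algebra_def closedin_subtopology by blast
  have "openin strong_operator_topology (- F)"
    using F(1) by (simp add: closedin_def strong_operator_topology_topspace Compl_eq_Diff_UNIV)
  then obtain U where U: "open U" "- F = blinfun_apply -` U"
    unfolding strong_operator_topology_def openin_pullback_topology by auto
  have "blinfun_apply p \<in> U"
    using F(2) U(2) p \<open>p \<notin> M\<close> by blast
  then obtain B where B: "finite {x. B x \<noteq> UNIV}" "\<And>x. open (B x)"
      "blinfun_apply p \<in> Pi\<^sub>E UNIV B" "Pi\<^sub>E UNIV B \<subseteq> U"
    using U(1) unfolding open_fun_def openin_product_topology_alt by auto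
  define X where "X = {x. B x \<noteq> UNIV}"
  have "\<exists>e>0. \<forall>y. dist y (p x) < e \<longrightarrow> y \<in> B x" for x
    using B(2,3) by (auto simp: open_dist PiE_iff)
  then obtain \<epsilon> where \<epsilon>: "\<And>x. \<epsilon> x > 0" "\<And>x y. dist y (p x) < \<epsilon> x \<Longrightarrow> y \<in> B x"
    by metis
  have finX: "finite X"
    using B(1) by (simp add: X_def)
  define e where "e = Min (insert 1 (\<epsilon> ` X))"
  have e: "e > 0" "\<And>x. x \<in> X \<Longrightarrow> e \<le> \<epsilon> x"
    using finX \<epsilon>(1) by (auto simp: e_def)
  obtain m where m: "m \<in> M" "\<And>x. x \<in> X \<Longrightarrow> dist (m x) (p x) < e"
    using approx[OF finX e(1)] by blast
  have "m x \<in> B x" for x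
    using m(2)[of x] e(2)[of x] \<epsilon>(2)[of "m x" x] by (cases "x \<in> X") (auto simp: X_def)
  then have "blinfun_apply m \<in> U"
    using B(4) by auto
  then show False
    using m(1) F(2) U(2) by blast
qed

text \<open>
  Write \<open>p = 1 - q\<close> with \<open>q\<close> the projection onto the joint kernel. Any \<open>R\<close> in the semigroup satisfies
  \<open>R q = q\<close>, so \<open>(1 - R) - p = - R p\<close>; this is small at prescribed vectors for suitable \<open>R\<close>.
\<close>

lemma joint_initial_projection:
  assumes M: "von_neumann_algebra M" and A: "A \<subseteq> partial_isometries M"
  obtains p where "p \<in> M" "\<And>x. p x \<in> orth (joint_kernel A)" "\<And>x. x - p x \<in> joint_kernel A"
proof -
  let ?N = "joint_kernel A"
  obtain q :: "'a \<Rightarrow>\<^sub>L 'a" where q: "\<And>x. q x \<in> ?N" "\<And>x z. z \<in> ?N \<Longrightarrow> inner (x - q x) z = 0"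
    using orthogonal_projection_exists[OF subspace_joint_kernel closed_joint_kernel, of A] by blast
  define p where "p = id_blinfun - q"
  have px: "p x = x - q x" for x
    by (simp add: p_def blinfun.diff_left)
  have p_orth: "p x \<in> orth ?N" for x
    using q(2) by (simp add: px orth_def)
  have AB: "A \<subseteq> bounded_operators"
    using A von_neumann_algebraD(1)[OF M] by (auto simp: partial_isometries_def)
  have N_scale: "c *\<^sub>C x \<in> ?N" if "x \<in> ?N" for c x
  proof -
    have "v (c *\<^sub>C x) = c *\<^sub>C v x" if "v \<in> A" for v
      using AB that by (auto simp: bounded_operators_def)
    moreover have "c *\<^sub>C (0::'a) = 0"
      by (rule linear_0[OF bounded_linear.linear[OF bounded_linear_scaleC]])
    ultimately show ?thesis
      using that by (simp add: joint_kernel_def)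
  qed
  \<comment> \<open>The defect \<open>d\<close> of complex homogeneity lies both in the joint kernel and in its complement.\<close>
  have "p (c *\<^sub>C x) = c *\<^sub>C p x" for c x
  proof -
    define d where "d = c *\<^sub>C q x - q (c *\<^sub>C x)"
    have "x = p x + q x"
      by (simp add: px)
    then have "c *\<^sub>C x = c *\<^sub>C p x + c *\<^sub>C q x"
      by (metis scaleC_add_right)
    then have d_eq: "d = p (c *\<^sub>C x) - c *\<^sub>C p x"
      unfolding d_def px[of "c *\<^sub>C x"] by (simp add: algebra_simps)
    have dN: "d \<in> ?N"
      unfolding d_def by (intro subspace_diff subspace_joint_kernel N_scale q)
    then have "inner (p (c *\<^sub>C x)) d = 0" "inner (c *\<^sub>C p x) d = 0"
      using p_orth N_scale by (auto simp: orth_def inner_scaleC_left)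
    then have "inner d d = 0"
      by (subst (1) d_eq) (simp add: inner_diff_left)
    then show ?thesis
      using d_eq by simp
  qed
  then have "p \<in> bounded_operators"
    by (simp add: bounded_operators_def)
  moreover have "\<exists>m\<in>M. \<forall>x\<in>X. dist (m x) (p x) < e" if "finite X" "e > 0" for X e
  proof -
    obtain R where R: "R \<in> damping_operators M A" "\<forall>u\<in>blinfun_apply p ` X. norm (R u) < e"
      using damping_small_finite[OF M A _ _ \<open>e > 0\<close>, of "blinfun_apply p ` X"] p_orth \<open>finite X\<close>
      by blast
    have "(id_blinfun - R) x - p x = - R (p x)" for x
    proof -
      have "R (q x) = q x"
        using R(1) q(1) by (simp add: damping_operators_def)
      then show ?thesis
        by (simp add: px blinfun.bilinear_simps)
    qed
    then have "\<forall>x\<in>X. dist ((id_blinfun - R) x) (p x) < e"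
      using R(2) by (simp add: dist_norm)
    moreover have "id_blinfun - R \<in> M"
      using R(1) by (simp add: damping_operators_def)
    ultimately show ?thesis
      by blast
  qed
  ultimately have "p \<in> M"
    by (rule strong_closure_in_algebra[OF M])
  then show ?thesis
    using p_orth q(1) by (intro that[of p]) (auto simp: px)
qed

section \<open>Suprema and infima\<close>

text \<open>
  The supremum is \<open>s = y p\<close> with \<open>p\<close> the joint initial projection. Two facts hold on initial spaces
  and hence on the range of \<open>p\<close>: all upper bounds agree, and each upper bound \<open>z\<close> satisfies
  \<open>z\<^sup>* z u = u\<close>. So \<open>s = z p\<close> and \<open>s\<^sup>* = p z\<^sup>*\<close> for every upper bound \<open>z\<close>, from which the
  relations for \<open>s\<close> to lie below \<open>z\<close> follow.
\<close>

lemma supremum_exists: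
  assumes M: "von_neumann_algebra M" and A: "A \<subseteq> partial_isometries M"
    and y: "y \<in> Upper (star_order M) A"
  shows "\<exists>s\<in>partial_isometries M. is_supremum (star_order M) s A"
proof -
  have AM: "A \<subseteq> M"
    using A by (auto simp: partial_isometries_def)
  note MB = von_neumann_algebraD(1)[OF M]
  obtain p where p: "p \<in> M" "\<And>x. p x \<in> orth (joint_kernel A)" "\<And>x. x - p x \<in> joint_kernel A"
    using joint_initial_projection[OF M A] by blast
  have p_eq: "p u = u" if "u \<in> orth (joint_kernel A)" for u
  proof -
    have "inner (u - p u) (u - p u) = 0"
      using that p(2)[of u] p(3)[of u] by (simp add: orth_def inner_diff_left)
    then show ?thesis
      by simp
  qed
  have pb: "p \<in> bounded_operators"
    using p(1) MB by blast
  have adj_p: "adj p = p"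
  proof (rule adj_eq_if_inner[OF pb])
    fix x y
    have "inner (p x) (y - p y) = 0" "inner (p y) (x - p x) = 0"
      using p(2,3) by (auto simp: orth_def)
    then show "inner (p x) y = inner x (p y)"
      by (simp add: inner_diff_right inner_commute)
  qed
  have vp: "v (p x) = v x" if "v \<in> A" for v x
    using p(3)[of x] that by (simp add: joint_kernel_def blinfun.diff_right)
  have adj_in: "adj v x \<in> orth (joint_kernel A)" if "v \<in> A" for v x
    using that AM MB inner_adj[of v]
    by (auto simp: orth_def joint_kernel_def inner_commute[of "adj v x"] subset_iff
        simp flip: inner_adj)
  have upper: "adj v (z x) = adj v (v x)" "z (adj v x) = v (adj v x)" "adj z (v x) = adj v (v x)"
    if z: "z \<in> Upper (star_order M) A" and v: "v \<in> A" for z v x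
  proof -
    have le: "v \<sqsubseteq>\<^bsub>star_order M\<^esub> z"
      using z v AM by (auto simp: Upper_def)
    then show "adj v (z x) = adj v (v x)" "z (adj v x) = v (adj v x)"
      by (simp_all add: star_le_iff)
    show "adj z (v x) = adj v (v x)"
      using z v AM by (intro adj_apply_eq_of_star_le[OF M _ _ le]) (auto simp: Upper_def)
  qed
  have isometric: "adj z (z u) = u"
    if z: "z \<in> Upper (star_order M) A" and u: "u \<in> orth (joint_kernel A)" for z u
  proof -
    have "orth (joint_kernel A) \<subseteq> {u. adj z (z u) = u}"
    proof (rule orth_joint_kernel_subset)
      show "subspace {u. adj z (z u) = u}"
        by (auto simp: subspace_def blinfun.bilinear_simps)
      show "closed {u. adj z (z u) = u}"
        by (intro closed_Collect_eq continuous_intros)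
      show "adj v x \<in> {u. adj z (z u) = u}" if "v \<in> A" for v x
        using adj_partial_isometry[OF M, of v x] A that by (auto simp: upper[OF z that])
    qed (use AM MB in blast)
    with u show ?thesis
      by blast
  qed
  have agree: "y u = z u"
    if z: "z \<in> Upper (star_order M) A" and u: "u \<in> orth (joint_kernel A)" for z u
  proof -
    have "orth (joint_kernel A) \<subseteq> {u. y u = z u}"
    proof (rule orth_joint_kernel_subset)
      show "subspace {u. y u = z u}"
        by (auto simp: subspace_def blinfun.bilinear_simps)
      show "closed {u. y u = z u}"
        by (intro closed_Collect_eq continuous_intros)
      show "adj v x \<in> {u. y u = z u}" if "v \<in> A" for v x
        using that by (simp add: upper[OF y that] upper[OF z that])
    qed (use AM MB in blast)
    with u show ?thesis
      by blast
  qed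
  define s where "s = y o\<^sub>L p"
  have s_eq: "s x = z (p x)" if "z \<in> Upper (star_order M) A" for z x
    using agree[OF that p(2)] by (simp add: s_def)
  have sM: "s \<in> M"
    unfolding s_def using y p(1) by (intro von_neumann_algebraD(6)[OF M]) (auto simp: Upper_def)
  have adj_s: "adj s x = p (adj z x)" if z: "z \<in> Upper (star_order M) A" for z x
  proof -
    have zb: "z \<in> bounded_operators"
      using z MB by (auto simp: Upper_def)
    have "adj s = p o\<^sub>L adj z"
    proof (rule adj_eq_if_inner)
      show "s \<in> bounded_operators"
        using sM MB by blast
      show "inner (s x) w = inner x ((p o\<^sub>L adj z) w)" for x w
        by (simp add: s_eq[OF z] inner_adj[OF zb] inner_adj[OF pb] adj_p)
    qed
    then show ?thesis
      by simp
  qed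
  have sP: "s \<in> partial_isometries M"
    using p_eq[OF p(2)] isometric[OF y p(2)]
    by (simp add: partial_isometry_iff[OF M sM] s_eq[OF y] adj_s[OF y])
  have s_upper: "v \<sqsubseteq>\<^bsub>star_order M\<^esub> s" if v: "v \<in> A" for v
    using p_eq[OF adj_in[OF v]]
    by (simp add: star_le_iff s_eq[OF y] upper[OF y v] vp[OF v])
  have s_least: "s \<sqsubseteq>\<^bsub>star_order M\<^esub> z" if z: "z \<in> Upper (star_order M) A" for z
  proof -
    have zb: "z \<in> bounded_operators"
      using z MB by (auto simp: Upper_def)
    \<comment> \<open>The identity \<open>p z\<^sup>* z = p\<close> is the adjoint of \<open>z\<^sup>* z p = p\<close>.\<close>
    have "p (adj z (z x)) = p x" for x
    proof -
      have "inner w (p (adj z (z x))) = inner w (p x)" for w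
      proof -
        have "inner w (p (adj z (z x))) = inner (z (p w)) (z x)"
          by (simp add: inner_adj[OF zb] inner_adj[OF pb] adj_p)
        also have "\<dots> = inner x (adj z (z (p w)))"
          by (simp add: inner_commute flip: inner_adj[OF zb])
        also have "\<dots> = inner w (p x)"
          using inner_adj[OF pb, of w x] by (simp add: isometric[OF z p(2)] adj_p inner_commute)
        finally show ?thesis .
      qed
      then show ?thesis
        using vector_eq_ldot by blast
    qed
    then show ?thesis
      using p_eq[OF p(2)] isometric[OF z p(2)]
      by (simp add: star_le_iff s_eq[OF z] adj_s[OF z])
  qed
  have "is_supremum (star_order M) s A"
    using sM s_upper s_least
    by (auto simp: is_supremum_def least_def Upper_def)
  with sP show ?thesis
    by blast
qed

theorem corollary3p4:
  fixes M :: "('a::complex_hilbert_space \<Rightarrow>\<^sub>L 'a) set"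
  assumes "von_neumann_algebra M"
  shows "(\<forall>A. A \<subseteq> partial_isometries M \<and> order_bounded (star_order M) A \<longrightarrow>
            (\<exists>s. is_supremum (star_order M) s A) \<and>
            (\<forall>s. is_supremum (star_order M) s A \<longrightarrow> s \<in> partial_isometries M)) \<and>
         (\<forall>A. A \<subseteq> partial_isometries M \<and> A \<noteq> {} \<longrightarrow>
            (\<exists>i. is_infimum (star_order M) i A) \<and>
            (\<forall>i. is_infimum (star_order M) i A \<longrightarrow> i \<in> partial_isometries M))"
proof (intro conjI allI impI; elim conjE)
  fix A
  assume A: "A \<subseteq> partial_isometries M" and bdd: "order_bounded (star_order M) A"
  obtain y where "y \<in> Upper (star_order M) A"
    using bdd by (auto simp: order_bounded_def)
  then obtain s where s: "s \<in> partial_isometries M" "is_supremum (star_order M) s A"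
    using supremum_exists[OF assms A] by blast
  then show "\<exists>s. is_supremum (star_order M) s A"
    by blast
  fix t
  assume "is_supremum (star_order M) t A"
  then have "t \<in> M" "t \<sqsubseteq>\<^bsub>star_order M\<^esub> s"
    using s(2) by (auto simp: is_supremum_def least_def)
  then show "t \<in> partial_isometries M"
    using star_le_partial_isometry[OF assms _ s(1)] by blast
next
  fix A
  assume A: "A \<subseteq> partial_isometries M" and "A \<noteq> {}"
  then obtain a where a: "a \<in> A"
    by blast
  have AM: "A \<subseteq> M"
    using A by (auto simp: partial_isometries_def)
  define L where "L = Lower (star_order M) A"
  have LM: "L \<subseteq> M"
    using Lower_closed[of "star_order M" A] by (simp add: L_def)
  have L_le: "z \<sqsubseteq>\<^bsub>star_order M\<^esub> b" if "z \<in> L" "b \<in> A" for z b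
    using that AM by (auto simp: L_def Lower_def)
  have LP: "L \<subseteq> partial_isometries M"
    using star_le_partial_isometry[OF assms] L_le[OF _ a] LM A a by blast
  have A_Upper: "A \<subseteq> Upper (star_order M) L"
    using L_le AM by (auto simp: Upper_def)
  then obtain s where s: "is_supremum (star_order M) s L"
    using supremum_exists[OF assms LP] a by blast
  have "s \<in> M" "s \<sqsubseteq>\<^bsub>star_order M\<^esub> b" if "b \<in> A" for b
    using s A_Upper that
    by (auto simp: is_supremum_def least_def)
  then have "s \<in> L"
    using a AM by (auto simp: L_def Lower_def)
  moreover have "z \<sqsubseteq>\<^bsub>star_order M\<^esub> s" if "z \<in> L" for z
    using s that LM
    by (auto simp: is_supremum_def least_def Upper_def)
  ultimately have "is_infimum (star_order M) s A"
    using LM by (simp add: is_infimum_def greatest_def flip: L_def)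
  then show "\<exists>i. is_infimum (star_order M) i A"
    by blast
  fix i
  assume "is_infimum (star_order M) i A"
  then have "i \<in> L"
    by (simp add: is_infimum_def greatest_def L_def)
  then show "i \<in> partial_isometries M"
    using LP by blast
qed

end
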